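(* If $X$ is a continuum (a connected compact Hausdorff space) such that $C(X)$ has quantifier elimination, then $X$ is indecomposable.
   Context: A continuum is indecomposable if it is not the union of two of its proper subcontinua. Quantifier elimination is in continuous logic for $\mathrm{C}^*$-algebras in the language of unital $\mathrm{C}^*$-algebras: $C(X)$ has it if for every formula $\phi(\bar x)$ (built from norms of $^*$-polynomials with complex coefficients and the unit, continuous connectives, and $\sup_{\|y\|\le m}$/$\inf_{\|y\|\le m}$) and $\varepsilon>0$ there is a quantifier-free $\psi$ with $|\phi^B(\bar c)-\psi^B(\bar c)|\le\varepsilon$ for all models $B$ of $\mathrm{Th}(C(X))$ and all tuples $\bar c$ of contractions. *)

theory Defs
  imports "HOL-Analysis.Analysis" "HOL-Algebra.Module"
begin

subsection \<open>Continua\<close>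

definition continuum :: "'a topology \<Rightarrow> bool"
  where "continuum X \<longleftrightarrow> compact_space X \<and> connected_space X \<and> Hausdorff_space X"

definition proper_subcontinuum :: "'a topology \<Rightarrow> 'a set \<Rightarrow> bool"
  where "proper_subcontinuum X K \<longleftrightarrow> K \<subset> topspace X \<and> continuum (subtopology X K)"

definition indecomposable :: "'a topology \<Rightarrow> bool"
  where "indecomposable X \<longleftrightarrow>
    \<not> (\<exists>K L. proper_subcontinuum X K \<and> proper_subcontinuum X L \<and> topspace X = K \<union> L)"


subsection \<open>Unital C*-algebras\<close>

definition complex_ring :: "complex ring"
  where "complex_ring = \<lparr>carrier = UNIV, mult = (*), one = 1, zero = 0, add = (+)\<rparr>"

record 'b cstar = "(complex, 'b) module" +
  adj :: "'b \<Rightarrow> 'b"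
  cnorm :: "'b \<Rightarrow> real"

text \<open>Multiplication need not be commutative, and the zero algebra is not excluded.\<close>

locale unital_cstar_algebra = ring A + module complex_ring A for A (structure) +
  assumes smult_mult_left:
      "\<lbrakk>x \<in> carrier A; y \<in> carrier A\<rbrakk> \<Longrightarrow> (c \<odot> x) \<otimes> y = c \<odot> (x \<otimes> y)"
    and smult_mult_right:
      "\<lbrakk>x \<in> carrier A; y \<in> carrier A\<rbrakk> \<Longrightarrow> x \<otimes> (c \<odot> y) = c \<odot> (x \<otimes> y)"
    and adj_closed: "x \<in> carrier A \<Longrightarrow> adj A x \<in> carrier A"
    and adj_adj: "x \<in> carrier A \<Longrightarrow> adj A (adj A x) = x"
    and adj_add:
      "\<lbrakk>x \<in> carrier A; y \<in> carrier A\<rbrakk> \<Longrightarrow> adj A (x \<oplus> y) = adj A x \<oplus> adj A y"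
    and adj_smult: "x \<in> carrier A \<Longrightarrow> adj A (c \<odot> x) = cnj c \<odot> adj A x"
    and adj_mult:
      "\<lbrakk>x \<in> carrier A; y \<in> carrier A\<rbrakk> \<Longrightarrow> adj A (x \<otimes> y) = adj A y \<otimes> adj A x"
    and cnorm_nonneg: "x \<in> carrier A \<Longrightarrow> 0 \<le> cnorm A x"
    and cnorm_eq_0_iff: "x \<in> carrier A \<Longrightarrow> cnorm A x = 0 \<longleftrightarrow> x = \<zero>"
    and cnorm_triangle:
      "\<lbrakk>x \<in> carrier A; y \<in> carrier A\<rbrakk> \<Longrightarrow> cnorm A (x \<oplus> y) \<le> cnorm A x + cnorm A y"
    and cnorm_smult: "x \<in> carrier A \<Longrightarrow> cnorm A (c \<odot> x) = cmod c * cnorm A x"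
    and cnorm_mult:
      "\<lbrakk>x \<in> carrier A; y \<in> carrier A\<rbrakk> \<Longrightarrow> cnorm A (x \<otimes> y) \<le> cnorm A x * cnorm A y"
    and cnorm_adj_mult: "x \<in> carrier A \<Longrightarrow> cnorm A (adj A x \<otimes> x) = (cnorm A x)\<^sup>2"
    and complete:
      "\<lbrakk>\<And>n::nat. s n \<in> carrier A;
        \<forall>e>0. \<exists>N. \<forall>m\<ge>N. \<forall>n\<ge>N. cnorm A (s m \<ominus> s n) < e\<rbrakk>
       \<Longrightarrow> \<exists>l\<in>carrier A. (\<lambda>n. cnorm A (s n \<ominus> l)) \<longlonglongrightarrow> 0"

text \<open>The algebra of continuous complex functions on \<open>X\<close>, with functions made extensional
  so that equality on the carrier is equality on the points of \<open>X\<close>.  Inserting \<open>0\<close> in the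
  supremum only matters for empty \<open>X\<close>.\<close>

definition C :: "'a topology \<Rightarrow> ('a \<Rightarrow> complex) cstar"
  where "C X = \<lparr>
    carrier = {f \<in> extensional (topspace X). continuous_map X euclidean f},
    mult = (\<lambda>f g. \<lambda>x\<in>topspace X. f x * g x),
    one = (\<lambda>x\<in>topspace X. 1),
    zero = (\<lambda>x\<in>topspace X. 0),
    add = (\<lambda>f g. \<lambda>x\<in>topspace X. f x + g x),
    smult = (\<lambda>c f. \<lambda>x\<in>topspace X. c * f x),
    adj = (\<lambda>f. \<lambda>x\<in>topspace X. cnj (f x)),
    cnorm = (\<lambda>f. Sup (insert 0 ((\<lambda>x. cmod (f x)) ` topspace X)))\<rparr>"


subsection \<open>Continuous logic for unital C*-algebras\<close>

datatype star_poly =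
    Var nat
  | Unit
  | Add star_poly star_poly
  | Mult star_poly star_poly
  | Scale complex star_poly
  | Adj star_poly

text \<open>\<open>Conn u \<phi>s\<close> applies the \<open>n\<close>-ary connective \<open>u\<close> to the list \<open>\<phi>s\<close> of length \<open>n\<close>, where
  \<open>u\<close> is read as a function on \<open>Euclidean_space n\<close>.  \<open>SupBall m x \<phi>\<close> and \<open>InfBall m x \<phi>\<close> bind
  the variable \<open>x\<close>, which ranges over the closed ball of radius \<open>m\<close>.\<close>

datatype fm =
    Norm star_poly
  | Conn "(nat \<Rightarrow> real) \<Rightarrow> real" "fm list"
  | SupBall nat nat fm
  | InfBall nat nat fm

primrec is_formula :: "fm \<Rightarrow> bool" where
  "is_formula (Norm p) \<longleftrightarrow> True"
| "is_formula (Conn u \<phi>s) \<longleftrightarrow>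
    continuous_map (Euclidean_space (length \<phi>s)) euclideanreal u \<and> list_all is_formula \<phi>s"
| "is_formula (SupBall m x \<phi>) \<longleftrightarrow> is_formula \<phi>"
| "is_formula (InfBall m x \<phi>) \<longleftrightarrow> is_formula \<phi>"

primrec quantifier_free :: "fm \<Rightarrow> bool" where
  "quantifier_free (Norm p) \<longleftrightarrow> True"
| "quantifier_free (Conn u \<phi>s) \<longleftrightarrow> list_all quantifier_free \<phi>s"
| "quantifier_free (SupBall m x \<phi>) \<longleftrightarrow> False"
| "quantifier_free (InfBall m x \<phi>) \<longleftrightarrow> False"

primrec poly_vars :: "star_poly \<Rightarrow> nat set" where
  "poly_vars (Var i) = {i}"
| "poly_vars Unit = {}"
| "poly_vars (Add p q) = poly_vars p \<union> poly_vars q"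
| "poly_vars (Mult p q) = poly_vars p \<union> poly_vars q"
| "poly_vars (Scale c p) = poly_vars p"
| "poly_vars (Adj p) = poly_vars p"

primrec free_vars :: "fm \<Rightarrow> nat set" where
  "free_vars (Norm p) = poly_vars p"
| "free_vars (Conn u \<phi>s) = \<Union> (set (map free_vars \<phi>s))"
| "free_vars (SupBall m x \<phi>) = free_vars \<phi> - {x}"
| "free_vars (InfBall m x \<phi>) = free_vars \<phi> - {x}"

primrec poly_val :: "'b cstar \<Rightarrow> (nat \<Rightarrow> 'b) \<Rightarrow> star_poly \<Rightarrow> 'b" where
  "poly_val B c (Var i) = c i"
| "poly_val B c Unit = \<one>\<^bsub>B\<^esub>"
| "poly_val B c (Add p q) = poly_val B c p \<oplus>\<^bsub>B\<^esub> poly_val B c q"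
| "poly_val B c (Mult p q) = poly_val B c p \<otimes>\<^bsub>B\<^esub> poly_val B c q"
| "poly_val B c (Scale a p) = a \<odot>\<^bsub>B\<^esub> poly_val B c p"
| "poly_val B c (Adj p) = adj B (poly_val B c p)"

primrec fm_val :: "'b cstar \<Rightarrow> fm \<Rightarrow> (nat \<Rightarrow> 'b) \<Rightarrow> real" where
  "fm_val B (Norm p) c = cnorm B (poly_val B c p)"
| "fm_val B (Conn u \<phi>s) c =
    u (\<lambda>i. if i < length \<phi>s then (map (fm_val B) \<phi>s ! i) c else 0)"
| "fm_val B (SupBall m x \<phi>) c =
    (SUP y\<in>{y \<in> carrier B. cnorm B y \<le> real m}. fm_val B \<phi> (c(x := y)))"
| "fm_val B (InfBall m x \<phi>) c =
    (INF y\<in>{y \<in> carrier B. cnorm B y \<le> real m}. fm_val B \<phi> (c(x := y)))"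

definition sentence :: "fm \<Rightarrow> bool"
  where "sentence \<phi> \<longleftrightarrow> is_formula \<phi> \<and> free_vars \<phi> = {}"

text \<open>The value of a sentence does not depend on the assignment; the zero assignment is an
  arbitrary choice.  Subtracting a constant is a connective, so algebras with
  the same theory agree on the value of every sentence, not only on those of value 0.\<close>

definition Th :: "'b cstar \<Rightarrow> fm set"
  where "Th A = {\<phi>. sentence \<phi> \<and> fm_val A \<phi> (\<lambda>_. \<zero>\<^bsub>A\<^esub>) = 0}"

definition is_model :: "'b cstar \<Rightarrow> fm set \<Rightarrow> bool"
  where "is_model B T \<longleftrightarrow>
    unital_cstar_algebra B \<and> (\<forall>\<phi>\<in>T. fm_val B \<phi> (\<lambda>_. \<zero>\<^bsub>B\<^esub>) = 0)"

text \<open>HOL cannot quantify over all types inside a formula, so the models \<open>B\<close> range over the algebras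
  whose carrier is any subset of the type in which \<open>A\<close> lives; these include \<open>A\<close> itself.
  No generality is lost: for fixed \<open>\<phi>\<close>, \<open>\<psi>\<close>, \<open>\<epsilon>\<close> the bound over all contractions is
  a condition on the value of a sentence, so it holds in one model of \<open>Th A\<close> iff it
  holds in all.\<close>

definition quantifier_elimination :: "'b cstar \<Rightarrow> bool"
  where "quantifier_elimination A \<longleftrightarrow>
    (\<forall>n \<phi> \<epsilon>. is_formula \<phi> \<and> free_vars \<phi> \<subseteq> {..<n} \<and> \<epsilon> > 0 \<longrightarrow>
      (\<exists>\<psi>. is_formula \<psi> \<and> quantifier_free \<psi> \<and> free_vars \<psi> \<subseteq> {..<n} \<and>
        (\<forall>(B :: 'b cstar) c. is_model B (Th A) \<and>
            (\<forall>i<n. c i \<in> carrier B \<and> cnorm B (c i) \<le> 1) \<longrightarrow>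
          \<bar>fm_val B \<phi> c - fm_val B \<psi> c\<bar> \<le> \<epsilon>)))"

end

theory Submission
  imports Defs
begin

text \<open>A quantifier-free formula sees only the joint range of a tuple in \<open>C X\<close>.  If \<open>X\<close> is the union
  of proper subcontinua \<open>K\<close> and \<open>L\<close>, there is a continuous \<open>f : X \<rightarrow> [-1,1]\<close>, onto, with
  \<open>f \<le> 0\<close> on \<open>K\<close> and \<open>f \<ge> 0\<close> on \<open>L\<close>.  The pairs \<open>(f\<^sup>-, f\<^sup>+)\<close> and
  \<open>(max 0 (2\<bar>f\<bar> - 1), max 0 (1 - 4 f\<^sup>2))\<close> have the same joint range, namely the cross
  \<open>[0,1] \<times> {0} \<union> {0} \<times> [0,1]\<close>.  The formula that takes the infimum over \<open>h\<close> of
  \<open>max (\<parallel>4h(1-h) - b\<parallel>, 1 - \<parallel>ha\<parallel>, 1 - \<parallel>(1-h)a\<parallel>)\<close>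
  tells them apart: it vanishes at the second pair, because there \<open>{a \<noteq> 0}\<close> splits along the value
  of \<open>h = f + 1/2\<close> truncated to \<open>[0,1]\<close>, but it is at least \<open>1/2\<close> at the first one,
  because \<open>b = 0\<close> on the connected set \<open>K\<close>, so \<open>h\<close> is near \<open>0\<close> or near \<open>1\<close> on all
  of \<open>K\<close>, and \<open>a\<close> vanishes off \<open>K\<close>.\<close>

section \<open>The algebra of continuous functions\<close>

lemma C_carrier: "f \<in> carrier (C X) \<longleftrightarrow> f \<in> extensional (topspace X) \<and> continuous_map X euclidean f"
  by (simp add: C_def)

lemma C_simps [simp]:
  "f \<otimes>\<^bsub>C X\<^esub> g = (\<lambda>x\<in>topspace X. f x * g x)"
  "\<one>\<^bsub>C X\<^esub> = (\<lambda>x\<in>topspace X. 1)"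
  "\<zero>\<^bsub>C X\<^esub> = (\<lambda>x\<in>topspace X. 0)"
  "f \<oplus>\<^bsub>C X\<^esub> g = (\<lambda>x\<in>topspace X. f x + g x)"
  "c \<odot>\<^bsub>C X\<^esub> f = (\<lambda>x\<in>topspace X. c * f x)"
  "adj (C X) f = (\<lambda>x\<in>topspace X. cnj (f x))"
  by (simp_all add: C_def)

lemma cnorm_C: "cnorm (C X) f = Sup (insert 0 ((\<lambda>x. cmod (f x)) ` topspace X))"
  by (simp add: C_def)

lemma restrict_in_C:
  assumes "continuous_map X euclidean f"
  shows "restrict f (topspace X) \<in> carrier (C X)"
  using assms continuous_map_eq[of X euclidean f "restrict f (topspace X)"]
  by (simp add: C_carrier)

lemma C_eqI:
  assumes "f \<in> carrier (C X)" "g \<in> carrier (C X)" "\<And>x. x \<in> topspace X \<Longrightarrow> f x = g x"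
  shows "f = g"
  using assms by (auto simp: C_carrier intro: extensionalityI)

lemma C_closed [simp]:
  assumes "f \<in> carrier (C X)"
  shows "(\<lambda>x\<in>topspace X. c * f x) \<in> carrier (C X)"
    and "(\<lambda>x\<in>topspace X. - f x) \<in> carrier (C X)"
    and "(\<lambda>x\<in>topspace X. cnj (f x)) \<in> carrier (C X)"
    and "g \<in> carrier (C X) \<Longrightarrow> (\<lambda>x\<in>topspace X. f x + g x) \<in> carrier (C X)"
    and "g \<in> carrier (C X) \<Longrightarrow> (\<lambda>x\<in>topspace X. f x * g x) \<in> carrier (C X)"
  using assms
  by (auto intro!: restrict_in_C tendsto_intros simp: C_carrier[of f] C_carrier[of g] continuous_map_atin)

lemma const_in_C [simp]: "(\<lambda>x\<in>topspace X. c) \<in> carrier (C X)"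
  by (rule restrict_in_C) simp

lemma restrict_C [simp]: "f \<in> carrier (C X) \<Longrightarrow> restrict f (topspace X) = f"
  by (simp add: C_carrier extensional_restrict)

text \<open>Compactness makes the image of \<open>f\<close> bounded. \<open>Sup\<close> says nothing
  useful about an unbounded set of reals, so pointwise estimates from \<open>cnorm\<close> rest on
  this.\<close>

lemma bdd_above_cmod_C:
  assumes "compact_space X" "f \<in> carrier (C X)"
  shows "bdd_above (insert 0 ((\<lambda>x. cmod (f x)) ` topspace X))"
proof -
  have "compactin euclidean (f ` topspace X)"
    using assms by (intro image_compactin[of X]) (auto simp: C_carrier compact_space_def)
  then have "bounded (f ` topspace X)"
    by (simp add: compact_imp_bounded)
  then show ?thesis
    by (simp add: image_image flip: bdd_above_norm)
qed

lemma cmod_le_cnorm_C: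
  assumes "compact_space X" "f \<in> carrier (C X)" "x \<in> topspace X"
  shows "cmod (f x) \<le> cnorm (C X) f"
  unfolding cnorm_C using assms by (intro cSup_upper bdd_above_cmod_C) auto

text \<open>The inserted \<open>0\<close> keeps the set nonempty even for empty \<open>X\<close>; it
  is also what the premise on the sign of \<open>r\<close> serves.\<close>

lemma cnorm_C_leI:
  assumes "0 \<le> r" "\<And>x. x \<in> topspace X \<Longrightarrow> cmod (f x) \<le> r"
  shows "cnorm (C X) f \<le> r"
  unfolding cnorm_C using assms by (intro cSup_least) auto

lemma cnorm_C_nonneg:
  assumes "compact_space X" "f \<in> carrier (C X)"
  shows "0 \<le> cnorm (C X) f"
  unfolding cnorm_C using assms by (intro cSup_upper bdd_above_cmod_C) auto

section \<open>The unital C*-algebra axioms for \<open>C X\<close>\<close>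

lemma ring_C: "ring (C X)"
proof (rule ringI)
  show "abelian_group (C X)"
  proof (rule abelian_groupI)
    fix f assume f: "f \<in> carrier (C X)"
    then show "\<exists>g\<in>carrier (C X). g \<oplus>\<^bsub>C X\<^esub> f = \<zero>\<^bsub>C X\<^esub>"
      by (intro bexI[of _ "\<lambda>x\<in>topspace X. - f x"]) (auto intro!: restrict_ext)
    show "\<zero>\<^bsub>C X\<^esub> \<oplus>\<^bsub>C X\<^esub> f = f"
      using f by (simp cong: restrict_cong)
  qed (auto intro!: restrict_ext simp: algebra_simps)
  show "monoid (C X)"
    by (rule monoidI) (auto intro!: restrict_ext cong: restrict_cong)
qed (auto intro!: restrict_ext simp: algebra_simps)

lemma cring_complex_ring: "cring complex_ring"
proof (rule cringI)
  show "abelian_group complex_ring"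
    by (rule abelian_groupI)
      (auto simp: complex_ring_def intro: exI[of _ "- x" for x])
  show "comm_monoid complex_ring"
    by (rule comm_monoidI) (auto simp: complex_ring_def)
qed (auto simp: complex_ring_def algebra_simps)

lemma module_C: "module complex_ring (C X)"
proof (rule moduleI[OF cring_complex_ring ring.is_abelian_group[OF ring_C]])
  fix f assume "f \<in> carrier (C X)"
  then show "\<one>\<^bsub>complex_ring\<^esub> \<odot>\<^bsub>C X\<^esub> f = f"
    by (auto simp: complex_ring_def intro!: C_eqI)
qed (auto intro!: restrict_ext simp: complex_ring_def algebra_simps)

lemma minus_C:
  assumes "f \<in> carrier (C X)" "g \<in> carrier (C X)"
  shows "f \<ominus>\<^bsub>C X\<^esub> g = (\<lambda>x\<in>topspace X. f x - g x)"
proof -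
  interpret ring "C X" by (rule ring_C)
  have "\<ominus>\<^bsub>C X\<^esub> g = (\<lambda>x\<in>topspace X. - g x)"
    using assms by (intro minus_equality) (auto intro!: restrict_ext)
  then show ?thesis
    by (auto intro!: restrict_ext simp: a_minus_def)
qed

text \<open>A Cauchy sequence in the supremum norm is uniformly Cauchy, and a uniform limit of
  continuous functions is continuous.\<close>

lemma complete_C:
  assumes "compact_space X" and s: "\<And>n::nat. s n \<in> carrier (C X)"
    and Cauchy: "\<forall>e>0. \<exists>N. \<forall>m\<ge>N. \<forall>n\<ge>N. cnorm (C X) (s m \<ominus>\<^bsub>C X\<^esub> s n) < e"
  shows "\<exists>l\<in>carrier (C X). (\<lambda>n. cnorm (C X) (s n \<ominus>\<^bsub>C X\<^esub> l)) \<longlonglongrightarrow> 0"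
proof -
  interpret ring "C X" by (rule ring_C)
  have "uniformly_Cauchy_on (topspace X) s"
    unfolding uniformly_Cauchy_on_def
  proof (intro allI impI)
    fix e :: real assume "e > 0"
    then obtain N where N: "\<And>m n. m \<ge> N \<Longrightarrow> n \<ge> N \<Longrightarrow> cnorm (C X) (s m \<ominus>\<^bsub>C X\<^esub> s n) < e"
      using Cauchy by blast
    have "dist (s m x) (s n x) < e" if "x \<in> topspace X" "m \<ge> N" "n \<ge> N" for x m n
      using cmod_le_cnorm_C[OF assms(1) minus_closed[OF s s] that(1), of m n] N[OF that(2,3)] that(1)
      by (simp add: minus_C s dist_norm)
    then show "\<exists>M. \<forall>x\<in>topspace X. \<forall>m\<ge>M. \<forall>n\<ge>M. dist (s m x) (s n x) < e"
      by blast
  qed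
  then obtain l where l: "uniform_limit (topspace X) s l sequentially"
    using Cauchy_uniformly_convergent uniformly_convergent_on_def by blast
  \<comment> \<open>The limit is determined only on \<open>topspace X\<close>; restricting makes it
    extensional, as the carrier demands.\<close>
  define l' where "l' = restrict l (topspace X)"
  have "continuous_map X Met_TC.mtopology l"
    using s uniform_limitD[OF l]
    by (intro Met_TC.continuous_map_uniform_limit[where F = sequentially and f = s])
      (auto simp: C_carrier)
  then have l'_in: "l' \<in> carrier (C X)"
    unfolding l'_def by (intro restrict_in_C) simp
  have "(\<lambda>n. cnorm (C X) (s n \<ominus>\<^bsub>C X\<^esub> l')) \<longlonglongrightarrow> 0"
  proof (rule tendstoI)
    fix e :: real assume "e > 0"
    \<comment> \<open>Strict pointwise bounds give only a non-strict bound on the supremum, hence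
      \<open>e / 2\<close>.\<close>
    then have "\<forall>\<^sub>F n in sequentially. \<forall>x\<in>topspace X. dist (s n x) (l x) < e / 2"
      by (intro uniform_limitD[OF l]) simp
    then show "\<forall>\<^sub>F n in sequentially. dist (cnorm (C X) (s n \<ominus>\<^bsub>C X\<^esub> l')) 0 < e"
    proof eventually_elim
      case (elim n)
      have "(s n \<ominus>\<^bsub>C X\<^esub> l') x = s n x - l x" if "x \<in> topspace X" for x
        using that unfolding minus_C[OF s l'_in] by (simp add: l'_def)
      then have "cnorm (C X) (s n \<ominus>\<^bsub>C X\<^esub> l') \<le> e / 2"
        using elim \<open>e > 0\<close> by (intro cnorm_C_leI) (simp_all add: dist_norm less_imp_le)
      then show ?case
        using \<open>e > 0\<close> cnorm_C_nonneg[OF assms(1) minus_closed[OF s l'_in], of n] by simp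
    qed
  qed
  with l'_in show ?thesis by blast
qed

lemma unital_cstar_algebra_C:
  assumes X: "compact_space X"
  shows "unital_cstar_algebra (C X)"
proof -
  interpret ring "C X" by (rule ring_C)
  interpret module complex_ring "C X" by (rule module_C)
  note le = cmod_le_cnorm_C[OF X] and ge0 = cnorm_C_nonneg[OF X]
  have norm_smult: "cnorm (C X) (c \<odot>\<^bsub>C X\<^esub> f) \<le> cmod c * cnorm (C X) f" if "f \<in> carrier (C X)" for c f
    using that by (intro cnorm_C_leI) (auto simp: norm_mult ge0 intro!: mult_left_mono le)
  show ?thesis
  proof
    fix f g assume f: "f \<in> carrier (C X)"
    show "adj (C X) (adj (C X) f) = f"
      using f by (simp cong: restrict_cong)
    show "0 \<le> cnorm (C X) f"
      using f by (rule ge0)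
    show "cnorm (C X) f = 0 \<longleftrightarrow> f = \<zero>\<^bsub>C X\<^esub>"
    proof
      assume "cnorm (C X) f = 0"
      then show "f = \<zero>\<^bsub>C X\<^esub>"
        using le[OF f] f by (intro C_eqI) auto
    next
      assume "f = \<zero>\<^bsub>C X\<^esub>"
      then have "cnorm (C X) f \<le> 0"
        by (intro cnorm_C_leI) auto
      with ge0[OF f] show "cnorm (C X) f = 0" by simp
    qed
    show "cnorm (C X) (c \<odot>\<^bsub>C X\<^esub> f) = cmod c * cnorm (C X) f" for c
    proof (rule antisym[OF norm_smult[OF f]])
      show "cmod c * cnorm (C X) f \<le> cnorm (C X) (c \<odot>\<^bsub>C X\<^esub> f)"
      proof (cases "c = 0")
        case True
        then show ?thesis
          using f by (simp add: ge0)
      next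
        case False
        \<comment> \<open>The reverse inequality is \<open>norm_smult\<close> for the scalar
          \<open>inverse c\<close> and the already scaled function.\<close>
        have "cnorm (C X) f = cnorm (C X) (inverse c \<odot>\<^bsub>C X\<^esub> (c \<odot>\<^bsub>C X\<^esub> f))"
          using False f by (simp cong: restrict_cong flip: mult.assoc)
        also have "\<dots> \<le> cmod (inverse c) * cnorm (C X) (c \<odot>\<^bsub>C X\<^esub> f)"
          using f by (intro norm_smult) simp
        finally show ?thesis
          using False by (simp add: norm_inverse norm_divide field_simps)
      qed
    qed
    have aff: "adj (C X) f \<otimes>\<^bsub>C X\<^esub> f \<in> carrier (C X)"
      using f unfolding C_simps by (intro C_closed)
    show "cnorm (C X) (adj (C X) f \<otimes>\<^bsub>C X\<^esub> f) = (cnorm (C X) f)\<^sup>2"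
    proof (rule antisym)
      show "cnorm (C X) (adj (C X) f \<otimes>\<^bsub>C X\<^esub> f) \<le> (cnorm (C X) f)\<^sup>2"
        using f by (intro cnorm_C_leI) (auto simp: norm_mult power2_eq_square ge0 intro!: mult_mono le)
      have "cnorm (C X) f \<le> sqrt (cnorm (C X) (adj (C X) f \<otimes>\<^bsub>C X\<^esub> f))"
      proof (rule cnorm_C_leI)
        fix x assume x: "x \<in> topspace X"
        show "cmod (f x) \<le> sqrt (cnorm (C X) (adj (C X) f \<otimes>\<^bsub>C X\<^esub> f))"
          using le[OF aff x] x
          by (intro real_le_rsqrt) (simp add: norm_mult power2_eq_square)
      qed (use ge0[OF aff] in simp)
      then have "(cnorm (C X) f)\<^sup>2 \<le> (sqrt (cnorm (C X) (adj (C X) f \<otimes>\<^bsub>C X\<^esub> f)))\<^sup>2"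
        using ge0[OF f] by (rule power_mono)
      then show "(cnorm (C X) f)\<^sup>2 \<le> cnorm (C X) (adj (C X) f \<otimes>\<^bsub>C X\<^esub> f)"
        using ge0[OF aff] by simp
    qed
    assume g: "g \<in> carrier (C X)"
    show "cnorm (C X) (f \<oplus>\<^bsub>C X\<^esub> g) \<le> cnorm (C X) f + cnorm (C X) g"
      using f g by (intro cnorm_C_leI) (auto simp: ge0 intro!: norm_triangle_le add_mono le)
    show "cnorm (C X) (f \<otimes>\<^bsub>C X\<^esub> g) \<le> cnorm (C X) f * cnorm (C X) g"
      using f g by (intro cnorm_C_leI) (auto simp: norm_mult ge0 intro!: mult_mono le)
  next
    fix s :: "nat \<Rightarrow> 'a \<Rightarrow> complex"
    assume "\<And>n. s n \<in> carrier (C X)"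
      "\<forall>e>0. \<exists>N. \<forall>m\<ge>N. \<forall>n\<ge>N. cnorm (C X) (s m \<ominus>\<^bsub>C X\<^esub> s n) < e"
    then show "\<exists>l\<in>carrier (C X). (\<lambda>n. cnorm (C X) (s n \<ominus>\<^bsub>C X\<^esub> l)) \<longlonglongrightarrow> 0"
      by (rule complete_C[OF X])
  qed (auto intro!: restrict_ext simp: algebra_simps)
qed

text \<open>Allows the bound from quantifier elimination to be used in \<open>C X\<close> itself,
  the one model that the argument examines.\<close>

lemma is_model_self: "unital_cstar_algebra A \<Longrightarrow> is_model A (Th A)"
  by (simp add: is_model_def Th_def)

section \<open>Quantifier-free formulas and joint ranges\<close>

text \<open>All operations of \<open>C X\<close> are pointwise on \<open>topspace X\<close>.\<close>

lemma poly_val_C_cong: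
  assumes "x \<in> topspace X" "y \<in> topspace X" "\<And>i. i \<in> poly_vars p \<Longrightarrow> c i x = d i y"
  shows "poly_val (C X) c p x = poly_val (C X) d p y"
  using assms by (induction p) auto

lemma range_poly_val_C_subset:
  assumes "\<And>x. x \<in> topspace X \<Longrightarrow> \<exists>y\<in>topspace X. \<forall>i\<in>poly_vars p. c i x = d i y"
  shows "(\<lambda>x. cmod (poly_val (C X) c p x)) ` topspace X
    \<subseteq> (\<lambda>x. cmod (poly_val (C X) d p x)) ` topspace X"
proof (rule image_subsetI)
  fix x assume x: "x \<in> topspace X"
  with assms obtain y where y: "y \<in> topspace X" "\<forall>i\<in>poly_vars p. c i x = d i y"
    by blast
  then have "poly_val (C X) c p x = poly_val (C X) d p y"
    using x by (intro poly_val_C_cong) auto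
  with y(1) show "cmod (poly_val (C X) c p x) \<in> (\<lambda>x. cmod (poly_val (C X) d p x)) ` topspace X"
    by auto
qed

text \<open>Hypotheses \<open>cd\<close> and \<open>dc\<close> say that the tuples have the same
  joint range. The norm of a polynomial is a supremum over that range, and connectives only combine
  such numbers.\<close>

lemma quantifier_free_fm_val_C_eq:
  assumes "quantifier_free \<psi>" "free_vars \<psi> \<subseteq> I"
    and cd: "\<And>x. x \<in> topspace X \<Longrightarrow> \<exists>y\<in>topspace X. \<forall>i\<in>I. c i x = d i y"
    and dc: "\<And>y. y \<in> topspace X \<Longrightarrow> \<exists>x\<in>topspace X. \<forall>i\<in>I. d i y = c i x"
  shows "fm_val (C X) \<psi> c = fm_val (C X) \<psi> d"
  using assms(1,2)
proof (induction \<psi>)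
  case (Norm p)
  then have p: "poly_vars p \<subseteq> I" by simp
  have "(\<lambda>x. cmod (poly_val (C X) c p x)) ` topspace X
      = (\<lambda>x. cmod (poly_val (C X) d p x)) ` topspace X"
    by (intro antisym range_poly_val_C_subset) (use cd dc p in \<open>meson subsetD\<close>)+
  then show ?case
    by (simp add: cnorm_C)
next
  case (Conn u \<phi>s)
  then have "fm_val (C X) (\<phi>s ! i) c = fm_val (C X) (\<phi>s ! i) d" if "i < length \<phi>s" for i
    using that by (intro Conn.IH nth_mem) (auto simp: list_all_length UN_subset_iff)
  then show ?case
    by (simp cong: if_cong)
qed simp_all

section \<open>A formula detecting disconnected supports\<close>

text \<open>Variable 0 is \<open>a\<close>, variable 1 is \<open>b\<close> and the bound variable 2 is \<open>h\<close>.\<close>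

definition splitting_connective :: "(nat \<Rightarrow> real) \<Rightarrow> real" where
  "splitting_connective v = max (v 0) (max (1 - v 1) (1 - v 2))"

definition one_minus :: "star_poly \<Rightarrow> star_poly" where
  "one_minus p = Add Unit (Scale (- 1) p)"

text \<open>The first norm controls how far \<open>h\<close> is from being a projection where
  \<open>b\<close> vanishes; the other two keep both pieces of \<open>a\<close> large. That norm
  also bounds the maximum below by 0, although \<open>1 - \<parallel>(1-h)a\<parallel>\<close> may
  be negative.\<close>

definition splitting_fm :: fm where
  "splitting_fm = InfBall 1 2 (Conn splitting_connective
    [Norm (Add (Scale 4 (Mult (Var 2) (one_minus (Var 2)))) (Scale (- 1) (Var 1))),
     Norm (Mult (Var 2) (Var 0)),
     Norm (Mult (one_minus (Var 2)) (Var 0))])"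

lemma is_formula_splitting_fm: "is_formula splitting_fm"
proof -
  have "continuous_map (Euclidean_space n) euclideanreal splitting_connective" for n
    unfolding splitting_connective_def Euclidean_space_def
    by (intro continuous_intros continuous_map_from_subtopology) auto
  then show ?thesis
    by (simp add: splitting_fm_def)
qed

lemma free_vars_splitting_fm: "free_vars splitting_fm \<subseteq> {..<2}"
  by (auto simp: splitting_fm_def one_minus_def)

lemma fm_val_splitting_fm:
  "fm_val (C X) splitting_fm c =
    (INF h\<in>{h \<in> carrier (C X). cnorm (C X) h \<le> 1}.
      max (cnorm (C X) (\<lambda>x\<in>topspace X. 4 * (h x * (1 - h x)) - c 1 x))
        (max (1 - cnorm (C X) (\<lambda>x\<in>topspace X. h x * c 0 x))
             (1 - cnorm (C X) (\<lambda>x\<in>topspace X. (1 - h x) * c 0 x))))"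
  by (simp add: splitting_fm_def one_minus_def splitting_connective_def numeral_2_eq_2
      cong: restrict_cong)

lemma splitting_terms_in_C:
  assumes "h \<in> carrier (C X)" "a \<in> carrier (C X)" "b \<in> carrier (C X)"
  shows "(\<lambda>x\<in>topspace X. 4 * (h x * (1 - h x)) - b x) \<in> carrier (C X)"
    and "(\<lambda>x\<in>topspace X. h x * a x) \<in> carrier (C X)"
    and "(\<lambda>x\<in>topspace X. (1 - h x) * a x) \<in> carrier (C X)"
  using assms
  by (auto intro!: restrict_in_C tendsto_intros
      simp: C_carrier[of h] C_carrier[of a] C_carrier[of b] continuous_map_atin)

text \<open>The given \<open>h\<close> is a witness for the infimum: the first norm is 0, and
  evaluation at \<open>p\<close> and \<open>q\<close> makes the norms of the two products at least
  1.\<close>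

lemma splitting_fm_nonpos:
  assumes X: "compact_space X" and c: "c 0 \<in> carrier (C X)" "c 1 \<in> carrier (C X)"
    and h: "h \<in> carrier (C X)" "cnorm (C X) h \<le> 1"
    and b: "\<And>x. x \<in> topspace X \<Longrightarrow> c 1 x = 4 * (h x * (1 - h x))"
    and p: "p \<in> topspace X" "h p = 1" "c 0 p = 1"
    and q: "q \<in> topspace X" "h q = 0" "c 0 q = 1"
  shows "fm_val (C X) splitting_fm c \<le> 0"
  unfolding fm_val_splitting_fm
proof (rule cINF_lower2[where x = h])
  show "h \<in> {h \<in> carrier (C X). cnorm (C X) h \<le> 1}"
    using h by simp
  have "cnorm (C X) (\<lambda>x\<in>topspace X. 4 * (h x * (1 - h x)) - c 1 x) \<le> 0"
    by (intro cnorm_C_leI) (auto simp: b simp del: One_nat_def)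
  moreover have "1 \<le> cnorm (C X) (\<lambda>x\<in>topspace X. h x * c 0 x)"
    using cmod_le_cnorm_C[OF X splitting_terms_in_C(2)[OF h(1) c] p(1)] p by simp
  moreover have "1 \<le> cnorm (C X) (\<lambda>x\<in>topspace X. (1 - h x) * c 0 x)"
    using cmod_le_cnorm_C[OF X splitting_terms_in_C(3)[OF h(1) c] q(1)] q by simp
  ultimately show "max (cnorm (C X) (\<lambda>x\<in>topspace X. 4 * (h x * (1 - h x)) - c 1 x))
      (max (1 - cnorm (C X) (\<lambda>x\<in>topspace X. h x * c 0 x))
        (1 - cnorm (C X) (\<lambda>x\<in>topspace X. (1 - h x) * c 0 x))) \<le> 0"
    by simp
  \<comment> \<open>The infimum lies below its value at \<open>h\<close> only if the set is bounded
    below; the first norm in the maximum gives the bound 0.\<close>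
  show "bdd_below ((\<lambda>h. max (cnorm (C X) (\<lambda>x\<in>topspace X. 4 * (h x * (1 - h x)) - c 1 x))
      (max (1 - cnorm (C X) (\<lambda>x\<in>topspace X. h x * c 0 x))
        (1 - cnorm (C X) (\<lambda>x\<in>topspace X. (1 - h x) * c 0 x))))
      ` {h \<in> carrier (C X). cnorm (C X) h \<le> 1})"
    by (rule bdd_belowI2[of _ 0])
      (auto simp: le_max_iff_disj simp del: One_nat_def intro!: disjI1 cnorm_C_nonneg[OF X] splitting_terms_in_C c)
qed

text \<open>The bound \<open>1 / 4\<close> forces each value of \<open>h\<close> on \<open>K\<close>
  into one of the open discs of radius \<open>1 / 2\<close> about 0 and 1. These are disjoint, so
  the connected image lies in a single disc.\<close>

lemma connectedin_near_0_or_1: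
  fixes h :: "'a \<Rightarrow> complex"
  assumes K: "connectedin X K" and h: "continuous_map X euclidean h"
    and small: "\<And>x. x \<in> K \<Longrightarrow> cmod (h x * (1 - h x)) < 1 / 4"
  shows "(\<forall>x\<in>K. cmod (h x) \<le> 1 / 2) \<or> (\<forall>x\<in>K. cmod (1 - h x) \<le> 1 / 2)"
proof -
  have near: "cmod z < 1 / 2 \<or> cmod (1 - z) < 1 / 2" if "cmod (z * (1 - z)) < 1 / 4" for z
  proof (rule ccontr)
    assume "\<not> ?thesis"
    then have "1 / 2 * (1 / 2) \<le> cmod z * cmod (1 - z)"
      by (intro mult_mono) auto
    with that show False by (simp add: norm_mult)
  qed
  have "connected (h ` K)"
    using connectedin_continuous_map_image[OF h K] by simp
  moreover have "open (ball 0 (1 / 2) :: complex set)" "open (ball 1 (1 / 2) :: complex set)"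
    by simp_all
  moreover have "ball 0 (1 / 2) \<inter> ball 1 (1 / 2) \<inter> h ` K = {}"
  proof -
    have False if "dist 0 z < 1 / 2" "dist 1 z < 1 / 2" for z :: complex
      using dist_triangle2[of 0 "1 :: complex" z] that by simp
    then show ?thesis by auto
  qed
  moreover have "h ` K \<subseteq> ball 0 (1 / 2) \<union> ball 1 (1 / 2)"
    using near[OF small] by (fastforce simp: dist_norm)
  ultimately have "ball 0 (1 / 2) \<inter> h ` K = {} \<or> ball 1 (1 / 2) \<inter> h ` K = {}"
    by (rule connectedD)
  with \<open>h ` K \<subseteq> ball 0 (1 / 2) \<union> ball 1 (1 / 2)\<close> show ?thesis
    by (force simp: dist_norm)
qed

text \<open>If the first norm is below \<open>1 / 2\<close>, connectedness of \<open>K\<close> puts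
  \<open>h\<close> or \<open>1 - h\<close> within \<open>1 / 2\<close> of 0 on all of
  \<open>K\<close>. As \<open>a\<close> vanishes off \<open>K\<close>, the corresponding product
  then has norm at most \<open>1 / 2\<close>.\<close>

lemma splitting_fm_ge_half:
  assumes X: "compact_space X" and K: "connectedin X K"
    and c: "c 0 \<in> carrier (C X)" "c 1 \<in> carrier (C X)"
    and a: "\<And>x. x \<in> topspace X \<Longrightarrow> cmod (c 0 x) \<le> 1"
      "\<And>x. x \<in> topspace X - K \<Longrightarrow> c 0 x = 0"
    and b: "\<And>x. x \<in> K \<Longrightarrow> c 1 x = 0"
  shows "1 / 2 \<le> fm_val (C X) splitting_fm c"
  unfolding fm_val_splitting_fm
proof (rule cINF_greatest)
  have "(\<lambda>x\<in>topspace X. 0) \<in> {h \<in> carrier (C X). cnorm (C X) h \<le> 1}"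
    by (auto intro: cnorm_C_leI)
  then show "{h \<in> carrier (C X). cnorm (C X) h \<le> 1} \<noteq> {}"
    by blast
next
  fix h assume "h \<in> {h \<in> carrier (C X). cnorm (C X) h \<le> 1}"
  then have h: "h \<in> carrier (C X)" by simp
  \<comment> \<open>Stated for a general factor \<open>g\<close>, since it is applied to both
    \<open>h\<close> and \<open>1 - h\<close>.\<close>
  have half: "cnorm (C X) (\<lambda>x\<in>topspace X. g x * c 0 x) \<le> 1 / 2"
    if "\<forall>x\<in>K. cmod (g x) \<le> 1 / 2" for g
  proof (rule cnorm_C_leI)
    fix x assume x: "x \<in> topspace X"
    show "cmod ((\<lambda>x\<in>topspace X. g x * c 0 x) x) \<le> 1 / 2"
    proof (cases "x \<in> K")
      case True
      then have "cmod (g x) * cmod (c 0 x) \<le> 1 / 2 * 1"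
        using that x by (intro mult_mono a) auto
      with x show ?thesis by (simp add: norm_mult)
    qed (use x a in auto)
  qed simp
  show "1 / 2 \<le> max (cnorm (C X) (\<lambda>x\<in>topspace X. 4 * (h x * (1 - h x)) - c 1 x))
      (max (1 - cnorm (C X) (\<lambda>x\<in>topspace X. h x * c 0 x))
        (1 - cnorm (C X) (\<lambda>x\<in>topspace X. (1 - h x) * c 0 x)))"
  proof (cases "1 / 2 \<le> cnorm (C X) (\<lambda>x\<in>topspace X. 4 * (h x * (1 - h x)) - c 1 x)")
    case False
    have "cmod (h x * (1 - h x)) < 1 / 4" if "x \<in> K" for x
    proof -
      have x: "x \<in> topspace X"
        using that K connectedin_subset_topspace by blast
      have "4 * cmod (h x * (1 - h x)) < 1 / 2"
        using cmod_le_cnorm_C[OF X splitting_terms_in_C(1)[OF h c] x] False b[OF that] x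
        by (simp add: norm_mult)
      then show ?thesis by simp
    qed
    then have "(\<forall>x\<in>K. cmod (h x) \<le> 1 / 2) \<or> (\<forall>x\<in>K. cmod (1 - h x) \<le> 1 / 2)"
      using h by (intro connectedin_near_0_or_1[OF K]) (auto simp: C_carrier)
    then show ?thesis
      using half[of h] half[of "\<lambda>x. 1 - h x"] by (auto simp: le_max_iff_disj)
  qed (simp add: le_max_iff_disj)
qed

section \<open>Decomposable continua\<close>

text \<open>Here \<open>f\<close> is a difference of two Urysohn functions, one vanishing on
  \<open>K\<close> and the other on \<open>L\<close>. It attains -1 and 1, and connectedness
  supplies the values between.\<close>

lemma decomposition_function:
  assumes X: "normal_space X" "t1_space X" "connected_space X"
    and KL: "closedin X K" "closedin X L" "topspace X = K \<union> L" "K \<noteq> topspace X" "L \<noteq> topspace X"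
  obtains f :: "'a \<Rightarrow> real" where "continuous_map X euclideanreal f" "f ` topspace X = {-1..1}"
    "\<And>x. x \<in> K \<Longrightarrow> f x \<le> 0" "\<And>x. x \<in> L \<Longrightarrow> 0 \<le> f x"
proof -
  have bump: "\<exists>g p. continuous_map X (top_of_set {0..1::real}) g \<and> g ` S \<subseteq> {0} \<and>
      p \<in> topspace X - S \<and> g p = 1"
    if S: "closedin X S" "S \<noteq> topspace X" for S
  proof -
    obtain p where p: "p \<in> topspace X - S"
      using S closedin_subset by fastforce
    then have "closedin X {p}" "disjnt S {p}"
      using X(2) by (auto simp: t1_space_closedin_singleton disjnt_def)
    then obtain g where "continuous_map X (top_of_set {0..1::real}) g" "g ` S \<subseteq> {0}" "g ` {p} \<subseteq> {1}"
      using Urysohn_lemma[OF X(1) S(1), of "{p}" 0 1] by auto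
    with p show ?thesis by auto
  qed
  obtain g p where g: "continuous_map X (top_of_set {0..1::real}) g" "g ` L \<subseteq> {0}"
      "p \<in> topspace X - L" "g p = 1"
    using bump[OF KL(2,5)] by blast
  obtain k q where k: "continuous_map X (top_of_set {0..1::real}) k" "k ` K \<subseteq> {0}"
      "q \<in> topspace X - K" "k q = 1"
    using bump[OF KL(1,4)] by blast
  define f where "f x = k x - g x" for x
  have range: "g x \<in> {0..1}" "k x \<in> {0..1}" if "x \<in> topspace X" for x
    using g(1) k(1) that by (auto simp: continuous_map_in_subtopology)
  have contf: "continuous_map X euclideanreal f"
    using g(1) k(1) unfolding f_def
    by (intro continuous_intros) (auto simp: continuous_map_in_subtopology)
  have "connected (f ` topspace X)"
    using connectedin_continuous_map_image[OF contf, of "topspace X"] X(3)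
    by (simp add: connectedin_topspace)
  \<comment> \<open>As \<open>p\<close> is not in \<open>L\<close> it lies in \<open>K\<close>,
    where \<open>k\<close> vanishes; symmetrically \<open>q\<close> lies in \<open>L\<close>, where
    \<open>g\<close> vanishes.\<close>
  moreover have "f p = - 1" "f q = 1"
    using g k KL(3) by (auto simp: f_def)
  then have "- 1 \<in> f ` topspace X" "1 \<in> f ` topspace X"
    using g(3) k(3) by (force intro: rev_image_eqI)+
  ultimately have "{-1..1} \<subseteq> f ` topspace X"
    by (rule connected_contains_Icc)
  moreover have "f ` topspace X \<subseteq> {-1..1}"
    using range by (fastforce simp: f_def)
  moreover have "f x \<le> 0" if "x \<in> K" for x
    using range[of x] k(2) that KL(3) by (auto simp: f_def)
  moreover have "0 \<le> f x" if "x \<in> L" for x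
    using range[of x] g(2) that KL(3) by (auto simp: f_def)
  ultimately show thesis
    using that contf by blast
qed

section \<open>Two parametrisations of the cross\<close>

text \<open>On the arm \<open>t \<le> 0\<close>, solving \<open>2 * s - 1 = - t\<close> gives
  \<open>s = (1 - t) / 2\<close>; on the other, solving \<open>1 - 4 * s\<^sup>2 = t\<close> gives
  \<open>s = sqrt (1 - t) / 2\<close>. In each case the other coordinate is truncated to 0.\<close>

lemma folded_cross:
  fixes t :: real
  assumes "t \<in> {-1..1}"
  shows "\<exists>s\<in>{-1..1}. max 0 (- t) = max 0 (2 * \<bar>s\<bar> - 1) \<and> max 0 t = max 0 (1 - 4 * s\<^sup>2)"
proof (cases "t \<le> 0")
  case True
  have "1 \<le> 4 * (1 / 2 - t / 2)\<^sup>2"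
    using True power_mono[of "1 / 2" "1 / 2 - t / 2" 2] by (simp add: power_divide)
  then show ?thesis
    using True assms by (intro bexI[of _ "1 / 2 - t / 2"]) auto
next
  case False
  then obtain r where "0 \<le> r" "r \<le> 1" "t = 1 - r\<^sup>2"
    using assms that[of "sqrt (1 - t)"] by auto
  then show ?thesis
    using False by (intro bexI[of _ "r / 2"]) (auto simp: power_divide)
qed

text \<open>The sign of \<open>t\<close> selects the arm: \<open>1 - 2 * \<bar>s\<bar>\<close> is
  nonpositive for \<open>\<bar>s\<bar> \<ge> 1 / 2\<close>, and \<open>1 - 4 * s\<^sup>2\<close> is
  positive otherwise.\<close>

lemma unfolded_cross:
  fixes s :: real
  assumes "s \<in> {-1..1}"
  shows "\<exists>t\<in>{-1..1}. max 0 (2 * \<bar>s\<bar> - 1) = max 0 (- t) \<and> max 0 (1 - 4 * s\<^sup>2) = max 0 t"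
proof (cases "1 / 2 \<le> \<bar>s\<bar>")
  case True
  then have "(1 / 2)\<^sup>2 \<le> s\<^sup>2"
    using power_mono[of "1 / 2" "\<bar>s\<bar>" 2] by simp
  with True show ?thesis
    using assms by (intro bexI[of _ "1 - 2 * \<bar>s\<bar>"]) (auto simp: power_divide)
next
  case False
  then have "s\<^sup>2 \<le> (1 / 2)\<^sup>2"
    using power_mono[of "\<bar>s\<bar>" "1 / 2" 2] by simp
  with False show ?thesis
    by (intro bexI[of _ "1 - 4 * s\<^sup>2"]) (auto simp: power_divide)
qed

text \<open>Every index other than 0 carries \<open>b\<close>, so the pair is a total assignment
  with all its entries in the carrier.\<close>

definition real_pair :: "'a topology \<Rightarrow> ('a \<Rightarrow> real) \<Rightarrow> ('a \<Rightarrow> real) \<Rightarrow> nat \<Rightarrow> 'a \<Rightarrow> complex" where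
  "real_pair X a b i = (\<lambda>x\<in>topspace X. complex_of_real (if i = 0 then a x else b x))"

lemma of_real_in_C:
  assumes "continuous_map X euclideanreal a"
  shows "(\<lambda>x\<in>topspace X. complex_of_real (a x)) \<in> carrier (C X)"
  using assms by (auto intro!: restrict_in_C tendsto_intros simp: continuous_map_atin)

lemma real_pair_in_C:
  assumes "continuous_map X euclideanreal a" "continuous_map X euclideanreal b"
  shows "real_pair X a b i \<in> carrier (C X)"
  unfolding real_pair_def using assms by (cases "i = 0") (auto intro: of_real_in_C)

lemma cnorm_real_pair_le_1:
  assumes "\<And>x. x \<in> topspace X \<Longrightarrow> \<bar>a x\<bar> \<le> 1" "\<And>x. x \<in> topspace X \<Longrightarrow> \<bar>b x\<bar> \<le> 1"
  shows "cnorm (C X) (real_pair X a b i) \<le> 1"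
  unfolding real_pair_def by (rule cnorm_C_leI) (use assms in auto)

theorem theorem4p2:
  fixes X :: "'a topology"
  assumes "continuum X"
    and "quantifier_elimination (C X)"
  shows "indecomposable X"
proof (rule ccontr)
  assume "\<not> indecomposable X"
  then obtain K L where KL: "proper_subcontinuum X K" "proper_subcontinuum X L" "topspace X = K \<union> L"
    unfolding indecomposable_def by blast
  have X: "compact_space X" "connected_space X" "Hausdorff_space X"
    using assms(1) by (auto simp: continuum_def)
  \<comment> \<open>A subcontinuum is compact, hence closed in the Hausdorff space
    \<open>X\<close>.\<close>
  have sub: "closedin X S" "connectedin X S" "S \<noteq> topspace X" if "proper_subcontinuum X S" for S
    using that X(3)
    by (auto simp: proper_subcontinuum_def continuum_def connectedin_def compactin_subspace
        intro!: compactin_imp_closedin)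
  have "normal_space X" "t1_space X"
    using X by (auto simp: compact_Hausdorff_or_regular_imp_normal_space Hausdorff_imp_t1_space)
  then obtain f where f: "continuous_map X euclideanreal f" "f ` topspace X = {-1..1}"
    and fK: "\<And>x. x \<in> K \<Longrightarrow> f x \<le> 0" and fL: "\<And>x. x \<in> L \<Longrightarrow> 0 \<le> f x"
    using decomposition_function[OF _ _ X(2) sub(1)[OF KL(1)] sub(1)[OF KL(2)] KL(3)
        sub(3)[OF KL(1)] sub(3)[OF KL(2)]] by blast
  have f_range: "- 1 \<le> f x" "f x \<le> 1" if "x \<in> topspace X" for x
    using f(2) that by auto
  have square_le: "(f x)\<^sup>2 \<le> 1" if "x \<in> topspace X" for x
    using f_range[OF that] by (simp add: abs_square_le_1 abs_le_iff)
  define c where "c = real_pair X (\<lambda>x. max 0 (- f x)) (\<lambda>x. max 0 (f x))"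
  define d where "d = real_pair X (\<lambda>x. max 0 (2 * \<bar>f x\<bar> - 1)) (\<lambda>x. max 0 (1 - 4 * (f x)\<^sup>2))"
  have in_C: "c i \<in> carrier (C X)" "d i \<in> carrier (C X)" for i
    unfolding c_def d_def using f(1)
    by (auto intro!: real_pair_in_C continuous_intros continuous_map_real_mult_left)
  have contraction: "cnorm (C X) (c i) \<le> 1" "cnorm (C X) (d i) \<le> 1" for i
    unfolding c_def d_def using f_range square_le
    by (auto intro!: cnorm_real_pair_le_1 simp: abs_le_iff max_def)

  \<comment> \<open>Since \<open>f\<close> maps onto \<open>{-1..1}\<close>, the real parameter
    found by \<open>folded_cross\<close> is the value of \<open>f\<close> at some point.\<close>
  have "\<exists>y\<in>topspace X. \<forall>i\<in>{..<2}. c i x = d i y" if x: "x \<in> topspace X" for x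
  proof -
    obtain y where y: "y \<in> topspace X" "max 0 (- f x) = max 0 (2 * \<bar>f y\<bar> - 1)"
        "max 0 (f x) = max 0 (1 - 4 * (f y)\<^sup>2)"
      using folded_cross[of "f x", folded f(2)] x by blast
    with x show ?thesis
      by (intro bexI[of _ y]) (auto simp: c_def d_def real_pair_def)
  qed
  moreover have "\<exists>x\<in>topspace X. \<forall>i\<in>{..<2}. d i y = c i x" if y: "y \<in> topspace X" for y
  proof -
    obtain x where x: "x \<in> topspace X" "max 0 (2 * \<bar>f y\<bar> - 1) = max 0 (- f x)"
        "max 0 (1 - 4 * (f y)\<^sup>2) = max 0 (f x)"
      using unfolded_cross[of "f y", folded f(2)] y by blast
    with y show ?thesis
      by (intro bexI[of _ x]) (auto simp: c_def d_def real_pair_def)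
  qed
  \<comment> \<open>The error \<open>1 / 5\<close> is incurred once for each pair, and
    \<open>2 / 5\<close> stays below the gap of \<open>1 / 2\<close>.\<close>
  moreover obtain \<psi> where \<psi>: "quantifier_free \<psi>" "free_vars \<psi> \<subseteq> {..<2}"
    and approx: "\<And>e. \<forall>i<2. e i \<in> carrier (C X) \<and> cnorm (C X) (e i) \<le> 1 \<Longrightarrow>
      \<bar>fm_val (C X) splitting_fm e - fm_val (C X) \<psi> e\<bar> \<le> 1 / 5"
    using assms(2)[unfolded quantifier_elimination_def, rule_format, of splitting_fm 2 "1 / 5"]
      is_formula_splitting_fm free_vars_splitting_fm
      is_model_self[OF unital_cstar_algebra_C[OF X(1)]]
    by fastforce
  ultimately have "fm_val (C X) \<psi> c = fm_val (C X) \<psi> d"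
    by (intro quantifier_free_fm_val_C_eq)
  moreover have "\<bar>fm_val (C X) splitting_fm c - fm_val (C X) \<psi> c\<bar> \<le> 1 / 5"
      "\<bar>fm_val (C X) splitting_fm d - fm_val (C X) \<psi> d\<bar> \<le> 1 / 5"
    by (rule approx, use in_C contraction in blast)+
  ultimately have close: "\<bar>fm_val (C X) splitting_fm c - fm_val (C X) splitting_fm d\<bar> \<le> 2 / 5"
    by linarith

  have "1 / 2 \<le> fm_val (C X) splitting_fm c"
  proof (rule splitting_fm_ge_half[OF X(1) sub(2)[OF KL(1)] in_C(1) in_C(1)])
    fix x
    show "cmod (c 0 x) \<le> 1" if "x \<in> topspace X"
      using f_range[OF that] that by (simp add: c_def real_pair_def)
    \<comment> \<open>Off \<open>K\<close> the point lies in \<open>L\<close>, where the negative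
      part of \<open>f\<close> is 0.\<close>
    show "c 0 x = 0" if "x \<in> topspace X - K"
      using fL[of x] KL(3) that by (auto simp: c_def real_pair_def)
    show "c 1 x = 0" if "x \<in> K"
      using fK[of x] KL(3) that by (auto simp: c_def real_pair_def)
  qed
  moreover have "fm_val (C X) splitting_fm d \<le> 0"
  proof -
    define \<eta> where "\<eta> t = max 0 (min 1 (t + 1 / 2))" for t :: real
    define h where "h = (\<lambda>x\<in>topspace X. complex_of_real (\<eta> (f x)))"
    \<comment> \<open>For \<open>\<bar>t\<bar> \<le> 1 / 2\<close> the right side is
      \<open>4 * (1 / 2 + t) * (1 / 2 - t)\<close>; outside this interval both sides are 0.\<close>
    have \<eta>: "max 0 (1 - 4 * t\<^sup>2) = 4 * (\<eta> t * (1 - \<eta> t))" for t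
    proof (cases "\<bar>t\<bar> \<le> 1 / 2")
      case True
      then have "t\<^sup>2 \<le> (1 / 2)\<^sup>2"
        using power_mono[of "\<bar>t\<bar>" "1 / 2" 2] by simp
      moreover have "\<eta> t = t + 1 / 2"
        using True by (auto simp: \<eta>_def)
      ultimately show ?thesis
        by (simp add: power2_eq_square algebra_simps)
    next
      case False
      then have "(1 / 2)\<^sup>2 \<le> t\<^sup>2"
        using power_mono[of "1 / 2" "\<bar>t\<bar>" 2] by simp
      moreover have "\<eta> t = 0 \<or> \<eta> t = 1"
        using False by (auto simp: \<eta>_def)
      ultimately show ?thesis
        by (auto simp: power2_eq_square)
    qed
    have "h \<in> carrier (C X)"
      unfolding h_def \<eta>_def using f(1) by (intro of_real_in_C continuous_intros) auto
    moreover have "cnorm (C X) h \<le> 1"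
      by (rule cnorm_C_leI) (auto simp: h_def \<eta>_def)
    moreover have "d 1 x = 4 * (h x * (1 - h x))" if "x \<in> topspace X" for x
      using that by (simp add: d_def real_pair_def h_def \<eta>)
    \<comment> \<open>At the two extreme values of \<open>f\<close> the first entry of
      \<open>d\<close> is 1, while \<open>h\<close> is 1 at one and 0 at the other.\<close>
    moreover have "- 1 \<in> f ` topspace X" "1 \<in> f ` topspace X"
      by (simp_all add: f(2))
    then obtain p q where "p \<in> topspace X" "f p = 1" "q \<in> topspace X" "f q = - 1"
      by auto
    then have "p \<in> topspace X" "h p = 1" "d 0 p = 1" "q \<in> topspace X" "h q = 0" "d 0 q = 1"
      by (simp_all add: h_def \<eta>_def d_def real_pair_def)
    ultimately show ?thesis
      using in_C by (intro splitting_fm_nonpos[OF X(1), where h = h and p = p and q = q])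
  qed
  ultimately show False
    using close by simp
qed

end
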